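(* For $k \in \mathbb{N} = \{1,2,\dots\}$ the following recursion is well-defined and constructs unsatisfiable hitting clause-sets $F_k$ with deficiency $\delta(F_k) = k$: 1. $F_1 := \{\{1\},\{-1\}\}$. 2. For $k \ge 2$ let $F_k$ be a full $a_2(k)$-expansion of $F_{i_S(k)}$. Furthermore $\mathrm{fc}(F_k) = S_2(k)$ holds for all $k \in \mathbb{N}$. Thus $S_2(k) \le \mathrm{FCH}(k)$ for all $k \in \mathbb{N}$.
   Context: Clause-sets. There is an infinite set of variables (containing $\mathbb{N}$); literals are variables $v$ and their complements $\overline{v}$, with $\overline{\overline{x}} = x$ (for $v \in \mathbb{N}$, $\overline{v} = -v$). A clause is a finite set of literals not containing a complementary pair $x, \overline{x}$; a clause-set is a finite set of clauses. $\mathrm{var}(C)$ is the set of underlying variables of the literals of the clause $C$, and $\mathrm{var}(F) = \bigcup_{C \in F} \mathrm{var}(C)$. Put $n(F) = |\mathrm{var}(F)|$, $c(F) = |F|$, and deficiency $\delta(F) = c(F) - n(F)$. $F$ is satisfiable if there is a clause $C$ with $C \cap D \neq \emptyset$ for all $D \in F$, otherwise unsatisfiable. $F$ is an unsatisfiable hitting clause-set if $F$ is unsatisfiable and for all $C, D \in F$ with $C \ne D$ there is $x \in C$ with $\overline{x} \in D$. A full clause of $F$ is $C \in F$ with $\mathrm{var}(C) = \mathrm{var}(F)$; $\mathrm{fc}(F)$ is the number of full clauses of $F$. $\mathrm{FCH}(k)$, for $k \in \mathbb{N}$, is the maximum of $\mathrm{fc}(F)$ over all unsatisfiable hitting clause-sets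 $F$ with $\delta(F) = k$. Full expansion. For a clause-set $F$ and $m \in \mathbb{N}$ with $\mathrm{fc}(F) \ge m$, a full $m$-expansion of $F$ is any clause-set $G$ obtained by choosing a set $F'$ of exactly $m$ full clauses of $F$, choosing a variable $v \notin \mathrm{var}(F)$, and replacing in $F$ each clause $C \in F'$ by the two clauses $C \cup \{v\}$ and $C \cup \{\overline{v}\}$. Number sequences. $S_2(k)$, for $k \ge 1$, is the smallest integer $n \ge 0$ such that $2^k$ divides $n!$. The sequence $a_2$ is defined by $a_2(0) = 0$, $a_2(1) = 1$, and $a_2(k) = a_2(k - a_2(k-1)) + a_2(k - 1 - a_2(k-2))$ for $k \ge 2$. The sequence $S'_2$ is defined by $S'_2(0) := 0$, $S'_2(1) := 2$, and for $k \ge 2$, $S'_2(k) := 2 (k-i+1)$ for the minimal $i \in \{1,\dots,k-1\}$ with $k-i+1 \le S'_2(i)$. The index is $i_S(k) := k + 1 - \frac{S'_2(k)}{2}$. *)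

theory Defs
  imports Main
begin

subsection \<open>Clause-sets\<close>

datatype 'v lit = Pos 'v | Neg 'v

primrec var_of :: "'v lit \<Rightarrow> 'v" where
  "var_of (Pos v) = v"
| "var_of (Neg v) = v"

primrec compl_lit :: "'v lit \<Rightarrow> 'v lit" where
  "compl_lit (Pos v) = Neg v"
| "compl_lit (Neg v) = Pos v"

definition is_clause :: "'v lit set \<Rightarrow> bool" where
  "is_clause C \<longleftrightarrow> finite C \<and> (\<forall>x\<in>C. compl_lit x \<notin> C)"

definition is_clause_set :: "'v lit set set \<Rightarrow> bool" where
  "is_clause_set F \<longleftrightarrow> finite F \<and> (\<forall>C\<in>F. is_clause C)"

definition vars_clause :: "'v lit set \<Rightarrow> 'v set" where
  "vars_clause C = var_of ` C"

definition vars :: "'v lit set set \<Rightarrow> 'v set" where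
  "vars F = (\<Union>C\<in>F. vars_clause C)"

definition deficiency :: "'v lit set set \<Rightarrow> int" where
  "deficiency F = int (card F) - int (card (vars F))"

definition satisfiable :: "'v lit set set \<Rightarrow> bool" where
  "satisfiable F \<longleftrightarrow> (\<exists>C. is_clause C \<and> (\<forall>D\<in>F. C \<inter> D \<noteq> {}))"

definition unsat_hitting :: "'v lit set set \<Rightarrow> bool" where
  "unsat_hitting F \<longleftrightarrow> is_clause_set F \<and> \<not> satisfiable F \<and>
     (\<forall>C\<in>F. \<forall>D\<in>F. C \<noteq> D \<longrightarrow> (\<exists>x\<in>C. compl_lit x \<in> D))"

definition full_clauses :: "'v lit set set \<Rightarrow> 'v lit set set" where
  "full_clauses F = {C \<in> F. vars_clause C = vars F}"

definition fc :: "'v lit set set \<Rightarrow> nat" where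
  "fc F = card (full_clauses F)"

text \<open>
  The type argument of \<open>FCH\<close> fixes the universe of variables. The maximum is taken with
  \<^const>\<open>Max\<close>, which is meaningful only for a finite nonempty set of values; that the set
  is finite and nonempty (for infinite \<^typ>\<open>'v\<close> and \<^prop>\<open>k \<ge> 1\<close>) is not part of the definition.
\<close>

definition FCH :: "'v itself \<Rightarrow> nat \<Rightarrow> nat" where
  "FCH _ k = Max {fc F | F :: 'v lit set set. unsat_hitting F \<and> deficiency F = int k}"

text \<open>\<open>full_expansion m F G\<close>: \<open>G\<close> is one of the possible full \<open>m\<close>-expansions of \<open>F\<close>.\<close>

definition full_expansion :: "nat \<Rightarrow> 'v lit set set \<Rightarrow> 'v lit set set \<Rightarrow> bool" where
  "full_expansion m F G \<longleftrightarrow> is_clause_set F \<and> m \<le> fc F \<and>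
     (\<exists>F' v. F' \<subseteq> full_clauses F \<and> card F' = m \<and> v \<notin> vars F \<and>
        G = (F - F') \<union> (\<Union>C\<in>F'. {C \<union> {Pos v}, C \<union> {Neg v}}))"


subsection \<open>Number sequences\<close>

definition S2 :: "nat \<Rightarrow> nat" where
  "S2 k = (LEAST n. 2 ^ k dvd (fact n :: nat))"

function (domintros) a2 :: "nat \<Rightarrow> nat" where
  "a2 0 = 0"
| "a2 (Suc 0) = 1"
| "a2 (Suc (Suc k)) = a2 (Suc (Suc k) - a2 (Suc k)) + a2 (Suc k - a2 k)"
  by pat_completeness auto

text \<open>
  The recursion for \<open>a2\<close> is nested. It terminates, and no subtraction in it is truncated,
  because consecutive values differ by 0 or 1.
\<close>

lemma a2_dom_step:
  "a2_dom n \<and> (n \<ge> 1 \<longrightarrow> a2 (n - 1) \<le> a2 n \<and> a2 n \<le> a2 (n - 1) + 1 \<and> 1 \<le> a2 n \<and> a2 n \<le> n)"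
proof (induction n rule: less_induct)
  case (less n)
  have dom: "a2_dom m" if "m < n" for m using less that by blast
  have up: "a2 m \<le> a2 (Suc m)" if "Suc m < n" for m
    using less[of "Suc m"] that by auto
  have le: "a2 (Suc m) \<le> a2 m + 1" if "Suc m < n" for m
    using less[of "Suc m"] that by auto
  have pos: "1 \<le> a2 m" "a2 m \<le> m" if "m < n" "1 \<le> m" for m
    using less[of m] that by auto
  have d0: "a2_dom 0" and d1: "a2_dom (Suc 0)" by (auto intro: a2.domintros)
  have v0: "a2 0 = 0" and v1: "a2 (Suc 0) = 1"
    using d0 d1 by (auto simp: a2.psimps)
  consider "n = 0" | "n = 1" | "n = 2" | "n = 3" | "n \<ge> 4" by linarith
  then show ?case
  proof cases
    case 1 then show ?thesis using d0 by simp
  next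
    case 2 then show ?thesis using d1 v0 v1 by simp
  next
    case 3
    have d2: "a2_dom (Suc (Suc 0))"
      by (rule a2.domintros) (simp_all add: d0 d1 v0 v1)
    have "a2 (Suc (Suc 0)) = 2" using d2 by (simp add: a2.psimps v0 v1)
    then show ?thesis using d2 3 v1 by (simp add: numeral_2_eq_2)
  next
    case 4
    have d2: "a2_dom (Suc (Suc 0))"
      by (rule a2.domintros) (simp_all add: d0 d1 v0 v1)
    have v2: "a2 (Suc (Suc 0)) = 2" using d2 by (simp add: a2.psimps v0 v1)
    have d3: "a2_dom (Suc (Suc (Suc 0)))"
      by (rule a2.domintros) (simp_all add: d1 d2 v1 v2)
    have "a2 (Suc (Suc (Suc 0))) = 2" using d3 by (simp add: a2.psimps v1 v2)
    then show ?thesis using d3 4 v2 by (simp add: numeral_3_eq_3)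
  next
    case 5
    then obtain k where n: "n = Suc (Suc (Suc (Suc k)))"
      using that[of "n - 4"] by linarith
    define p where "p = n - a2 (Suc (Suc (Suc k)))"
    define q where "q = Suc (Suc (Suc k)) - a2 (Suc (Suc k))"
    define r where "r = Suc (Suc k) - a2 (Suc k)"
    define s where "s = Suc k - a2 k"
    have b3: "1 \<le> a2 (Suc (Suc (Suc k)))" "a2 (Suc (Suc (Suc k))) \<le> Suc (Suc (Suc k))"
      and b2: "1 \<le> a2 (Suc (Suc k))" "a2 (Suc (Suc k)) \<le> Suc (Suc k)"
      and b1: "1 \<le> a2 (Suc k)" "a2 (Suc k) \<le> Suc k"
      using pos n by auto
    have b0: "a2 k \<le> k" using pos(2)[of k] v0 n by (cases k) auto
    have dn: "a2_dom n" unfolding n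
      by (rule a2.domintros) (use dom n b3 in auto)
    have en: "a2 n = a2 p + a2 q"
      using dn unfolding n p_def q_def by (simp add: a2.psimps)
    have e3: "a2 (Suc (Suc (Suc k))) = a2 q + a2 r"
      using dom[of "Suc (Suc (Suc k))"] unfolding n q_def r_def by (simp add: a2.psimps)
    have e2: "a2 (Suc (Suc k)) = a2 r + a2 s"
      using dom[of "Suc (Suc k)"] unfolding n r_def s_def by (simp add: a2.psimps)
    have pq: "p = q \<and> a2 (Suc (Suc (Suc k))) = a2 (Suc (Suc k)) + 1
           \<or> p = Suc q \<and> a2 (Suc (Suc (Suc k))) = a2 (Suc (Suc k))"
      using up[of "Suc (Suc k)"] le[of "Suc (Suc k)"] b3 b2 unfolding p_def q_def n by auto
    have qr: "q = r \<or> q = Suc r"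
      using up[of "Suc k"] le[of "Suc k"] b2 b1 unfolding q_def r_def n by auto
    have rs: "r = s \<or> r = Suc s"
      using up[of k] le[of k] b1 b0 unfolding r_def s_def n by auto
    have pn: "p < n" "q < n" "r < n" "s < n"
      using b3 b2 b1 unfolding p_def q_def r_def s_def n by auto
    have mq: "a2 r \<le> a2 q" using qr up[of r] pn by auto
    have mp: "a2 q \<le> a2 p" "a2 p \<le> a2 q + 1" using pq up[of q] le[of q] pn by auto
    have mr: "a2 s \<le> a2 r" using rs up[of s] pn by auto
    have lq: "a2 q \<le> a2 r + 1" using qr le[of r] pn by auto
    have "a2 p \<le> a2 r + 1"
      using pq
    proof
      assume "p = q \<and> a2 (Suc (Suc (Suc k))) = a2 (Suc (Suc k)) + 1"
      then show ?thesis using lq by auto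
    next
      assume "p = Suc q \<and> a2 (Suc (Suc (Suc k))) = a2 (Suc (Suc k))"
      then have "a2 q = a2 r" using e3 e2 mq mr by linarith
      then show ?thesis using mp by linarith
    qed
    then show ?thesis using dn en e3 mp mq b3 unfolding n by auto
  qed
qed

termination a2
proof (relation "measure (\<lambda>n. n)")
  fix k
  have "1 \<le> a2 (Suc k)" using a2_dom_step[of "Suc k"] by simp
  then show "(Suc (Suc k) - a2 (Suc k), Suc (Suc k)) \<in> measure (\<lambda>n. n)" by simp
qed auto

lemma a2_rec:
  assumes "k \<ge> 2"
  shows "a2 k = a2 (k - a2 (k - 1)) + a2 (k - 1 - a2 (k - 2))"
proof -
  obtain j where "k = Suc (Suc j)" using assms that[of "k - 2"] by linarith
  then show ?thesis by simp
qed

lemma a2_args_not_truncated: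
  assumes "k \<ge> 2"
  shows "a2 (k - 1) \<le> k" and "a2 (k - 2) \<le> k - 1"
proof -
  have "a2 n \<le> n" for n using a2_dom_step[of n] by (cases "n = 0") auto
  from this[of "k - 1"] this[of "k - 2"]
  show "a2 (k - 1) \<le> k" and "a2 (k - 2) \<le> k - 1" using assms by linarith+
qed

context
  notes conj_cong [fundef_cong]
begin

fun S2' :: "nat \<Rightarrow> nat" where
  "S2' k = (if k = 0 then 0 else if k = 1 then 2
     else 2 * (k - (LEAST i. 1 \<le> i \<and> i \<le> k - 1 \<and> k - i + 1 \<le> S2' i) + 1))"

end

declare S2'.simps [simp del]

text \<open>The minimum in the definition of \<open>S2'\<close> is taken over a nonempty set of indices:\<close>

lemma S2'_index_exists:
  assumes "k \<ge> 2"
  shows "1 \<le> k - 1 \<and> k - 1 \<le> k - 1 \<and> k - (k - 1) + 1 \<le> S2' (k - 1)"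
  using assms by (subst S2'.simps) auto

text \<open>
  \<open>S2' k\<close> is always even and the subtraction below is not truncated for \<open>k \<ge> 1\<close>, so natural number
  arithmetic agrees with the intended one.
\<close>

definition i_S :: "nat \<Rightarrow> nat" where
  "i_S k = k + 1 - S2' k div 2"

lemma S2'_even_bounded: "even (S2' k)" "S2' k div 2 \<le> k"
proof -
  show "even (S2' k)" by (subst S2'.simps) auto
  show "S2' k div 2 \<le> k"
  proof (cases "k \<ge> 2")
    case True
    define i where "i = (LEAST i. 1 \<le> i \<and> i \<le> k - 1 \<and> k - i + 1 \<le> S2' i)"
    have "1 \<le> i \<and> i \<le> k - 1 \<and> k - i + 1 \<le> S2' i"
      unfolding i_def by (rule LeastI) (rule S2'_index_exists[OF True])
    moreover have "S2' k = 2 * (k - i + 1)"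
      unfolding i_def by (subst S2'.simps) (use True in auto)
    ultimately show ?thesis using True by auto
  next
    case False
    then have "k = 0 \<or> k = 1" by auto
    then show ?thesis by (auto simp: S2'.simps[of 0] S2'.simps[of 1] S2'.simps[of "Suc 0"])
  qed
qed


subsection \<open>The recursive construction\<close>

text \<open>
  The variables of type \<open>'v\<close> contain a copy of the positive natural numbers, embedded by \<open>\<nu>\<close>.
  At every step the full expansion involves choices (of full clauses and of a new variable), so
  the recursion does not determine a unique sequence. \<open>construction \<nu> I F\<close> states that the sequence
  \<open>F\<close> obeys the recursion at all indices in \<open>I\<close>: for \<open>I = {1..<k}\<close> it is a run of the recursion up to
  stage \<open>k - 1\<close>, and for \<open>I = {1..}\<close> a complete run.
\<close>

definition construction :: "(nat \<Rightarrow> 'v) \<Rightarrow> nat set \<Rightarrow> (nat \<Rightarrow> 'v lit set set) \<Rightarrow> bool" where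
  "construction \<nu> I F \<longleftrightarrow>
     (\<forall>k\<in>I. if k = 1 then F k = {{Pos (\<nu> 1)}, {Neg (\<nu> 1)}}
            else full_expansion (a2 k) (F (i_S k)) (F k))"

end

theory Submission
  imports Defs "HOL-Computational_Algebra.Primes"
begin

text \<open>
  All number sequences are controlled by \<open>fact_val\<close>, the 2-adic valuation \<open>v\<close> of the factorial.
  Since \<open>v (2 * m) = m + v m\<close>, half of \<open>S2 k\<close> is the least \<open>m\<close> with \<open>k \<le> m + v m\<close>; call it \<open>b k\<close>.
  The Galois connection between \<open>b\<close> and \<open>\<lambda>m. m + v m\<close> turns the recursions of \<open>a2\<close> and \<open>S2'\<close> into
  inequalities between values of \<open>v\<close>, and gives \<open>a2 = b\<close> and \<open>S2' = 2 * b\<close>. A full \<open>m\<close>-expansion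
  (\<open>m \<ge> 1\<close>) preserves unsatisfiable hitting clause-sets, increases the deficiency by \<open>m - 1\<close> and has
  exactly \<open>2 * m\<close> full clauses.

  The maximum defining \<open>FCH k\<close> exists because \<open>fc F \<le> 2 * k\<close>: flipping one literal \<open>l\<close> of a full clause
  \<open>D\<close> gives an assignment that falsifies a clause containing the complement of \<open>l\<close> and otherwise
  contained in \<open>D\<close>. If \<open>x \<notin> D\<close>, this yields \<open>n(F)\<close> clauses without \<open>x\<close>, so \<open>x\<close> occurs at most \<open>k\<close> times.
  Two distinct full clauses disagree on some variable, each of whose literals thus occurs at
  most \<open>k\<close> times, and every full clause contains one of these two literals.
\<close>

section \<open>The number sequences\<close>

definition fact_val :: "nat \<Rightarrow> nat" where
  "fact_val n = multiplicity 2 (fact n :: nat)"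

lemma power_dvd_fact_iff: "2 ^ k dvd (fact n :: nat) \<longleftrightarrow> k \<le> fact_val n"
  unfolding fact_val_def by (rule power_dvd_iff_le_multiplicity) auto

lemma fact_val_0: "fact_val 0 = 0"
  by (simp add: fact_val_def)

lemma fact_val_Suc: "fact_val (Suc n) = multiplicity 2 (Suc n) + fact_val n"
  unfolding fact_val_def fact_Suc of_nat_id
  by (rule prime_elem_multiplicity_mult_distrib) auto

lemma fact_val_Suc_even: "even n \<Longrightarrow> fact_val (Suc n) = fact_val n"
  by (simp add: fact_val_Suc not_dvd_imp_multiplicity_0)

text \<open>Only the \<open>m\<close> even factors of \<open>fact (2 * m)\<close> count; halving
  each of them leaves \<open>fact m\<close>.\<close>

lemma fact_val_double: "fact_val (2 * m) = m + fact_val m"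
proof (induction m)
  case (Suc m)
  have "multiplicity 2 (2 * Suc m) = Suc (multiplicity 2 (Suc m))"
    by (rule multiplicity_times_same) auto
  moreover have "fact_val (2 * Suc m) = multiplicity 2 (2 * Suc m) + fact_val (2 * m)"
    using fact_val_Suc[of "Suc (2 * m)"] fact_val_Suc_even[of "2 * m"] by simp
  ultimately show ?case
    using Suc by (simp add: fact_val_Suc)
qed (simp add: fact_val_0)

lemma fact_val_mono: "m \<le> n \<Longrightarrow> fact_val m \<le> fact_val n"
  by (rule lift_Suc_mono_le[of fact_val]) (simp_all add: fact_val_Suc)

section \<open>Galois connections for \<open>half_S2\<close> and \<open>S2\<close>\<close>

definition half_S2 :: "nat \<Rightarrow> nat" where
  "half_S2 k = (LEAST m. k \<le> m + fact_val m)"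

text \<open>\<open>m + fact_val m\<close> is monotone in \<open>m\<close> and has reached
  \<open>k\<close> at \<open>m = k\<close>.\<close>

lemma half_S2_le_iff: "half_S2 k \<le> m \<longleftrightarrow> k \<le> m + fact_val m"
proof
  have "k \<le> half_S2 k + fact_val (half_S2 k)"
    unfolding half_S2_def by (rule LeastI[of _ k]) simp
  then show "k \<le> m + fact_val m" if "half_S2 k \<le> m"
    using that fact_val_mono[OF that] by linarith
qed (simp add: half_S2_def Least_le)

lemma S2_le_iff: "S2 k \<le> n \<longleftrightarrow> k \<le> fact_val n"
proof
  have "k \<le> fact_val (2 * k)"
    by (simp add: fact_val_double)
  then have "k \<le> fact_val (S2 k)"
    unfolding S2_def power_dvd_fact_iff by (rule LeastI)
  then show "k \<le> fact_val n" if "S2 k \<le> n"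
    using that fact_val_mono[OF that] by linarith
qed (simp add: S2_def Least_le power_dvd_fact_iff)

lemma S2_eq_half_S2: "S2 k = 2 * half_S2 k"
proof (rule antisym)
  show "S2 k \<le> 2 * half_S2 k"
    unfolding S2_le_iff fact_val_double using half_S2_le_iff by blast
  \<comment> \<open>Rounding an odd \<open>S2 k\<close> down loses no factor 2, so
    \<open>S2 k div 2\<close> already qualifies for \<open>half_S2\<close>.\<close>
  have "fact_val (S2 k) = fact_val (2 * (S2 k div 2))"
    using fact_val_Suc_even[of "2 * (S2 k div 2)"] by (cases "even (S2 k)") (auto elim!: oddE)
  moreover have "k \<le> fact_val (S2 k)"
    using S2_le_iff by blast
  ultimately have "half_S2 k \<le> S2 k div 2"
    unfolding half_S2_le_iff fact_val_double by simp
  then show "2 * half_S2 k \<le> S2 k"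
    by linarith
qed

lemma half_S2_0: "half_S2 0 = 0"
  by (simp add: half_S2_def fact_val_0)

lemma half_S2_le: "half_S2 k \<le> k"
  by (simp add: half_S2_le_iff)

lemma half_S2_pos: "1 \<le> k \<Longrightarrow> 1 \<le> half_S2 k"
  using half_S2_le_iff[of k 0] by (simp add: fact_val_0)

lemma half_S2_1: "half_S2 (Suc 0) = 1"
  using half_S2_pos[of 1] half_S2_le[of 1] by simp

lemma half_S2_ge_2: "2 \<le> k \<Longrightarrow> 2 \<le> half_S2 k"
  using half_S2_le_iff[of k 1] fact_val_Suc_even[of 0] by (simp add: fact_val_0)

section \<open>Solving the recursion of \<open>S2'\<close>\<close>

text \<open>Negated, the left side reads \<open>i \<le> fact_val (k - i)\<close>; adding
  \<open>k - i\<close> on both sides gives the negated right side. The condition on \<open>i\<close>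
  in \<open>S2'\<close> thus becomes a threshold.\<close>

lemma le_S2_iff_le_half_S2:
  assumes "1 \<le> i" "i \<le> k"
  shows "k - i + 1 \<le> S2 i \<longleftrightarrow> k - i + 1 \<le> half_S2 k"
proof -
  have "k - i + 1 \<le> S2 i \<longleftrightarrow> \<not> i \<le> fact_val (k - i)"
    by (auto simp flip: S2_le_iff)
  also have "\<dots> \<longleftrightarrow> \<not> k \<le> (k - i) + fact_val (k - i)"
    using assms by auto
  also have "\<dots> \<longleftrightarrow> k - i + 1 \<le> half_S2 k"
    by (auto simp flip: half_S2_le_iff)
  finally show ?thesis .
qed

lemma S2'_eq_half_S2: "S2' k = 2 * half_S2 k"
proof (induction k rule: less_induct)
  case (less k)
  consider "k = 0" | "k = 1" | "2 \<le> k"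
    by linarith
  then show ?case
  proof cases
    case 3
    have *: "1 \<le> i \<and> i \<le> k - 1 \<and> k - i + 1 \<le> S2' i \<longleftrightarrow>
        1 \<le> i \<and> i \<le> k - 1 \<and> k + 1 - half_S2 k \<le> i" for i
      using less[of i] le_S2_iff_le_half_S2[of i k] 3 by (auto simp: S2_eq_half_S2)
    \<comment> \<open>As \<open>half_S2 k\<close> lies between 2 and \<open>k\<close>, the threshold
      itself is in the range from 1 to \<open>k - 1\<close>.\<close>
    have "(LEAST i. 1 \<le> i \<and> i \<le> k - 1 \<and> k - i + 1 \<le> S2' i) = k + 1 - half_S2 k"
      unfolding * by (rule Least_equality) (use half_S2_le[of k] half_S2_ge_2[OF 3] in auto)
    then show ?thesis
      using 3 half_S2_le[of k] half_S2_ge_2[OF 3] by (subst S2'.simps) auto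
  qed (simp_all add: S2'.simps[of 0] S2'.simps[of "Suc 0"] half_S2_0 half_S2_1)
qed

section \<open>Solving the recursion of \<open>a2\<close>\<close>

text \<open>At \<open>k\<close> and at \<open>k - 1\<close> this evaluates the two summands of the
  \<open>a2\<close> recursion.\<close>

lemma half_S2_nested:
  assumes "1 \<le> k"
  shows "half_S2 (k - half_S2 (k - 1)) = (half_S2 k + 1) div 2"
proof -
  define t where "t = half_S2 (k - 1)"
  have t_le: "k - 1 \<le> t + fact_val t"
    unfolding t_def using half_S2_le_iff by blast
  have t_gt: "t - 1 + fact_val (t - 1) < k - 1" if "1 \<le> t"
    using half_S2_le_iff[of "k - 1" "t - 1"] that unfolding t_def by linarith
  \<comment> \<open>Numbers with the same upper bounds \<open>s\<close> are equal. The Galois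
    connection turns the left bound into \<open>k - t \<le> fact_val (2 * s)\<close>, and the right
    one means \<open>half_S2 k \<le> 2 * s\<close>.\<close>
  have "half_S2 (k - t) \<le> s \<longleftrightarrow> (half_S2 k + 1) div 2 \<le> s" for s
  proof -
    have "k - t \<le> fact_val (2 * s) \<longleftrightarrow> k \<le> 2 * s + fact_val (2 * s)"
    proof
      \<comment> \<open>If \<open>t < 2 * s\<close>, the valuation at \<open>t\<close> is strictly
        below that at \<open>2 * s\<close>; this gap absorbs the 1 in \<open>t_le\<close>.\<close>
      assume le: "k \<le> 2 * s + fact_val (2 * s)"
      show "k - t \<le> fact_val (2 * s)"
      proof (cases "2 * s \<le> t")
        case False
        then have "fact_val t \<le> fact_val (2 * (s - 1) + 1)"
          by (intro fact_val_mono) simp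
        also have "\<dots> = fact_val (2 * (s - 1))"
          using fact_val_Suc_even[of "2 * (s - 1)"] by simp
        finally have "fact_val t < fact_val (2 * s)"
          using False fact_val_mono[of "s - 1" s] by (simp add: fact_val_double)
        then show ?thesis
          using t_le by linarith
      qed (use le in linarith)
    next
      assume le: "k - t \<le> fact_val (2 * s)"
      \<comment> \<open>Failure would force \<open>2 * s < t\<close>, and minimality of
        \<open>t\<close> would contradict monotonicity of the valuation.\<close>
      show "k \<le> 2 * s + fact_val (2 * s)"
      proof (rule ccontr)
        assume gt: "\<not> ?thesis"
        then have "2 * s \<le> t - 1" "1 \<le> t"
          using le by linarith+
        then show False
          using t_gt fact_val_mono[of "2 * s" "t - 1"] le gt by linarith
      qed
    qed
    also have "k \<le> 2 * s + fact_val (2 * s) \<longleftrightarrow> (half_S2 k + 1) div 2 \<le> s"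
      unfolding half_S2_le_iff[symmetric] by linarith
    finally show ?thesis
      by (simp add: half_S2_le_iff fact_val_double)
  qed
  then show ?thesis
    unfolding t_def by (metis order_refl order_antisym)
qed

text \<open>From \<open>k - 1\<close> to \<open>k\<close>, \<open>half_S2\<close> stays or grows by
  1. The rounded-up halves of consecutive numbers add up to the larger one; a repeated value must be
  even.\<close>

lemma half_S2_split:
  assumes "1 \<le> k"
  shows "half_S2 k = (half_S2 k + 1) div 2 + (half_S2 (k - 1) + 1) div 2"
proof -
  define t where "t = half_S2 (k - 1)"
  have t_le: "k - 1 \<le> t + fact_val t"
    unfolding t_def using half_S2_le_iff by blast
  have "k \<le> half_S2 k + fact_val (half_S2 k)"
    using half_S2_le_iff by blast
  then have mono: "t \<le> half_S2 k"
    unfolding t_def half_S2_le_iff by linarith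
  have "half_S2 k \<le> t + 1"
    unfolding half_S2_le_iff using t_le fact_val_mono[of t "t + 1"] by linarith
  \<comment> \<open>From \<open>2 * s\<close> to \<open>2 * s + 1\<close> the function
    \<open>m + fact_val m\<close> grows by only 1, so \<open>half_S2\<close> takes an odd value only
    once.\<close>
  moreover have "even t" if eq: "half_S2 k = t"
  proof (rule ccontr)
    assume "odd t"
    then obtain s where s: "t = Suc (2 * s)"
      by (auto elim: oddE)
    have "\<not> k - 1 \<le> 2 * s + fact_val (2 * s)"
      unfolding half_S2_le_iff[symmetric] using s t_def by simp
    moreover have "k \<le> t + fact_val t"
      unfolding half_S2_le_iff[symmetric] using eq by simp
    ultimately show False
      using s fact_val_Suc_even[of "2 * s"] by simp
  qed
  ultimately show ?thesis
    using mono unfolding t_def[symmetric] by (cases "half_S2 k = t") (auto elim!: evenE)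
qed

lemma a2_eq_half_S2: "a2 k = half_S2 k"
proof (induction k rule: less_induct)
  case (less k)
  consider "k = 0" | "k = 1" | "2 \<le> k"
    by linarith
  then show ?case
  proof cases
    case 3
    have "k - half_S2 (k - 1) < k"
      using 3 half_S2_pos[of "k - 1"] by linarith
    then have "a2 k = half_S2 (k - half_S2 (k - 1)) + half_S2 (k - 1 - half_S2 (k - 1 - 1))"
      using 3 less a2_rec[OF 3] by (simp add: numeral_2_eq_2)
    also have "\<dots> = half_S2 k"
      using 3 half_S2_nested[of k] half_S2_nested[of "k - 1"] half_S2_split[of k] by simp
    finally show ?thesis .
  qed (simp_all add: half_S2_0 half_S2_1)
qed

lemma S2_eq_a2: "S2 k = 2 * a2 k"
  by (simp add: S2_eq_half_S2 a2_eq_half_S2)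

lemma i_S_eq: "i_S k = k + 1 - a2 k"
  by (simp add: i_S_def S2'_eq_half_S2 a2_eq_half_S2)

lemma a2_bounds: "2 \<le> k \<Longrightarrow> 2 \<le> a2 k \<and> a2 k \<le> k"
  by (simp add: a2_eq_half_S2 half_S2_ge_2 half_S2_le)

lemma i_S_bounds: "2 \<le> k \<Longrightarrow> 1 \<le> i_S k \<and> i_S k < k"
  using a2_bounds[of k] by (auto simp: i_S_eq)

text \<open>At \<open>i = i_S k\<close> the number \<open>k - i + 1\<close> is \<open>a2 k\<close>
  itself, so the threshold is met with equality. This supplies the full clauses for stage
  \<open>k\<close>.\<close>

lemma a2_le_S2_i_S:
  assumes "2 \<le> k"
  shows "a2 k \<le> S2 (i_S k)"
  using le_S2_iff_le_half_S2[of "i_S k" k] a2_bounds[OF assms]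
  by (auto simp: i_S_eq a2_eq_half_S2)


section \<open>Full expansions\<close>

lemma compl_lit_compl_lit [simp]: "compl_lit (compl_lit x) = x"
  by (cases x) auto

lemma compl_lit_eq_iff [simp]: "compl_lit x = compl_lit y \<longleftrightarrow> x = y"
  by (metis compl_lit_compl_lit)

lemma compl_lit_neq [simp]: "compl_lit x \<noteq> x"
  by (cases x) auto

lemma var_of_compl_lit [simp]: "var_of (compl_lit x) = var_of x"
  by (cases x) auto

lemma var_of_eq_iff: "var_of x = var_of y \<longleftrightarrow> x = y \<or> x = compl_lit y"
  by (cases x; cases y) auto

lemma finite_vars: "is_clause_set F \<Longrightarrow> finite (vars F)"
  by (auto simp: is_clause_set_def is_clause_def vars_def vars_clause_def)

lemma vars_clause_insert: "vars_clause (insert x C) = insert (var_of x) (vars_clause C)"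
  by (simp add: vars_clause_def)

lemma vars_clause_subset: "C \<in> F \<Longrightarrow> vars_clause C \<subseteq> vars F"
  by (auto simp: vars_def)

lemma not_in_vars: "v \<notin> vars F \<Longrightarrow> C \<in> F \<Longrightarrow> x \<in> C \<Longrightarrow> var_of x \<noteq> v"
  by (auto simp: vars_def vars_clause_def)

definition split_clauses :: "'v \<Rightarrow> 'v lit set set \<Rightarrow> 'v lit set set" where
  "split_clauses v F' = insert (Pos v) ` F' \<union> insert (Neg v) ` F'"

lemma split_clausesE:
  assumes "C \<in> split_clauses v F'"
  obtains D y where "D \<in> F'" "C = insert y D" "y = Pos v \<or> y = Neg v"
  using assms by (auto simp: split_clauses_def)

lemma full_expansion_iff:
  "full_expansion m F G \<longleftrightarrow> is_clause_set F \<and> m \<le> fc F \<and>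
    (\<exists>F' v. F' \<subseteq> full_clauses F \<and> card F' = m \<and> v \<notin> vars F \<and> G = (F - F') \<union> split_clauses v F')"
proof -
  have "(\<Union>C\<in>F'. {C \<union> {Pos v}, C \<union> {Neg v}}) = split_clauses v F'" for F' :: "'a lit set set" and v
    by (auto simp: split_clauses_def)
  then show ?thesis
    unfolding full_expansion_def by simp
qed

lemma card_split_clauses:
  assumes "finite F'" "F' \<subseteq> F" "v \<notin> vars F"
  shows "card (split_clauses v F') = 2 * card F'"
proof -
  have nin: "Pos v \<notin> C" "Neg v \<notin> C" if "C \<in> F'" for C
    using that assms not_in_vars[of v F C "Pos v"] not_in_vars[of v F C "Neg v"] by auto
  have "inj_on (insert y) F'" if "y = Pos v \<or> y = Neg v" for y
    using that nin by (intro inj_onI) (metis insert_ident)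
  moreover have "insert (Pos v) ` F' \<inter> insert (Neg v) ` F' = {}"
    using nin by auto
  ultimately show ?thesis
    unfolding split_clauses_def using assms(1) by (simp add: card_Un_disjoint card_image)
qed

text \<open>The splits add \<open>m\<close> clauses and one variable. Old clauses lack
  \<open>v\<close>, so exactly the split clauses are full; \<open>m \<ge> 1\<close> makes
  \<open>v\<close> occur in \<open>G\<close>.\<close>

lemma full_expansion_properties:
  assumes exp: "full_expansion m F G" and hit: "unsat_hitting F" and m: "1 \<le> m"
  shows "unsat_hitting G" "deficiency G = deficiency F + int m - 1" "fc G = 2 * m"
proof -
  obtain F' v where F': "F' \<subseteq> full_clauses F" "card F' = m" "v \<notin> vars F"
    and G: "G = (F - F') \<union> split_clauses v F'"
    using exp unfolding full_expansion_iff by blast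
  have cs: "is_clause_set F"
    and clash: "\<And>C D. C \<in> F \<Longrightarrow> D \<in> F \<Longrightarrow> C \<noteq> D \<Longrightarrow> \<exists>x\<in>C. compl_lit x \<in> D"
    using hit unfolding unsat_hitting_def by blast+
  have finF: "finite F" and clF: "\<And>C. C \<in> F \<Longrightarrow> is_clause C"
    using cs unfolding is_clause_set_def by blast+
  have sub: "F' \<subseteq> F" and full: "\<And>C. C \<in> F' \<Longrightarrow> vars_clause C = vars F"
    using F'(1) unfolding full_clauses_def by blast+
  have finF': "finite F'"
    using finite_subset[OF sub finF] .
  have fresh: "var_of x \<noteq> v" if "C \<in> F" "x \<in> C" for C x
    using not_in_vars[OF F'(3) that] .
  have split_vars: "vars_clause C = insert v (vars F)" if "C \<in> split_clauses v F'" for C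
    using that full by (auto elim!: split_clausesE simp: vars_clause_insert)
  have nonempty: "split_clauses v F' \<noteq> {}"
    using F'(2) m by (auto simp: split_clauses_def)
  have varsG: "vars G = insert v (vars F)"
  proof -
    have "vars G = vars (F - F') \<union> vars (split_clauses v F')"
      by (simp add: G vars_def)
    moreover have "vars (split_clauses v F') = insert v (vars F)"
      using split_vars nonempty by (auto simp: vars_def)
    moreover have "vars (F - F') \<subseteq> vars F"
      by (auto simp: vars_def)
    ultimately show ?thesis
      by auto
  qed
  have old_vars: "v \<notin> vars_clause C" if "C \<in> F" for C
    using vars_clause_subset[OF that] F'(3) by blast
  have disj: "(F - F') \<inter> split_clauses v F' = {}"
    using split_vars old_vars by blast
  have finS: "finite (split_clauses v F')"
    using finF' by (simp add: split_clauses_def)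
  have "card F' \<le> card F"
    using sub finF by (rule card_mono[rotated])
  then have "card G = card F + m"
    unfolding G using disj finF finS F' sub finF'
    by (simp add: card_Un_disjoint card_split_clauses[OF finF' sub F'(3)] card_Diff_subset)
  moreover have "card (vars G) = card (vars F) + 1"
    using varsG F'(3) finite_vars[OF cs] by simp
  ultimately show "deficiency G = deficiency F + int m - 1"
    by (simp add: deficiency_def)
  have "full_clauses G = split_clauses v F'"
    using split_vars old_vars unfolding full_clauses_def varsG by (auto simp: G)
  then show "fc G = 2 * m"
    unfolding fc_def using card_split_clauses[OF finF' sub F'(3)] F'(2) by simp
  have "is_clause C" if "C \<in> G" for C
  proof (cases "C \<in> F")
    case False
    then have "C \<in> split_clauses v F'"
      using that by (simp add: G)
    then obtain D y where D: "D \<in> F'" "C = insert y D" "y = Pos v \<or> y = Neg v"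
      by (rule split_clausesE)
    then have "D \<in> F"
      using sub by blast
    then have "compl_lit y \<notin> D"
      using D(3) fresh[of D "compl_lit y"] by auto
    moreover from this have "compl_lit x \<noteq> y" if "x \<in> D" for x
      using that by auto
    moreover have "is_clause D"
      using clF \<open>D \<in> F\<close> .
    ultimately show ?thesis
      unfolding D(2) is_clause_def by auto
  qed (use clF in blast)
  then have csG: "is_clause_set G"
    using finF finS by (simp add: is_clause_set_def G)
  have "\<not> satisfiable G"
  proof
    assume "satisfiable G"
    then obtain E where E: "is_clause E" "\<And>D. D \<in> G \<Longrightarrow> E \<inter> D \<noteq> {}"
      unfolding satisfiable_def by blast
    have "E \<inter> D \<noteq> {}" if "D \<in> F" for D
    proof (cases "D \<in> F'")
      \<comment> \<open>\<open>E\<close> contains at most one literal of \<open>v\<close>, so for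
        one of the two halves it must meet \<open>D\<close> itself.\<close>
      case True
      then have "E \<inter> insert (Pos v) D \<noteq> {}" "E \<inter> insert (Neg v) D \<noteq> {}"
        using E(2) by (auto simp: G split_clauses_def simp del: Int_insert_right)
      moreover have "\<not> (Pos v \<in> E \<and> Neg v \<in> E)"
        using E(1) unfolding is_clause_def by (metis compl_lit.simps(1))
      ultimately show ?thesis
        by blast
    qed (use E(2) that in \<open>simp add: G\<close>)
    then show False
      using hit E(1) unfolding unsat_hitting_def satisfiable_def by blast
  qed
  moreover have "\<exists>x\<in>C. compl_lit x \<in> D" if "C \<in> G" "D \<in> G" "C \<noteq> D" for C D
  proof -
    \<comment> \<open>Every clause of \<open>G\<close> extends a parent in \<open>F\<close>.
      Distinct parents pass on their clash; distinct clauses with a common parent are its two halves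
      and clash in \<open>v\<close>.\<close>
    have lift: "\<exists>C0\<in>F. C0 \<subseteq> C \<and> (C = C0 \<and> C0 \<notin> F' \<or> C0 \<in> F' \<and> (C = insert (Pos v) C0 \<or> C = insert (Neg v) C0))"
      if "C \<in> G" for C
      using that sub by (auto simp: G split_clauses_def)
    obtain C0 where C0: "C0 \<in> F" "C0 \<subseteq> C"
      "C = C0 \<and> C0 \<notin> F' \<or> C0 \<in> F' \<and> (C = insert (Pos v) C0 \<or> C = insert (Neg v) C0)"
      using lift[OF \<open>C \<in> G\<close>] by blast
    obtain D0 where D0: "D0 \<in> F" "D0 \<subseteq> D"
      "D = D0 \<and> D0 \<notin> F' \<or> D0 \<in> F' \<and> (D = insert (Pos v) D0 \<or> D = insert (Neg v) D0)"
      using lift[OF \<open>D \<in> G\<close>] by blast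
    show ?thesis
    proof (cases "C0 = D0")
      case False
      then show ?thesis
        using clash[OF C0(1) D0(1)] C0(2) D0(2) by blast
    next
      case True
      then have "Pos v \<in> C \<and> Neg v \<in> D \<or> Neg v \<in> C \<and> Pos v \<in> D"
        using C0(3) D0(3) \<open>C \<noteq> D\<close> by blast
      then show ?thesis
        by (metis compl_lit.simps)
    qed
  qed
  ultimately show "unsat_hitting G"
    using csG unfolding unsat_hitting_def by blast
qed

lemma full_expansion_exists:
  fixes F :: "'v lit set set"
  assumes "infinite (UNIV :: 'v set)" "is_clause_set F" "m \<le> fc F"
  shows "\<exists>G. full_expansion m F G"
proof -
  obtain F' where "F' \<subseteq> full_clauses F" "card F' = m"
    using assms(3) obtain_subset_with_card_n unfolding fc_def by metis
  moreover obtain v where "v \<notin> vars F"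
    using ex_new_if_finite[OF assms(1) finite_vars[OF assms(2)]] by blast
  ultimately show ?thesis
    using assms unfolding full_expansion_iff by blast
qed

lemma unsat_hitting_unit_pair:
  fixes v :: 'v
  defines "F \<equiv> {{Pos v}, {Neg v}}"
  shows "unsat_hitting F" "deficiency F = 1" "fc F = 2"
proof -
  have "is_clause_set F"
    by (auto simp: F_def is_clause_set_def is_clause_def)
  moreover have "\<not> satisfiable F"
  proof
    assume "satisfiable F"
    then obtain E where "is_clause E" "Pos v \<in> E" "Neg v \<in> E"
      by (auto simp: F_def satisfiable_def)
    then show False
      unfolding is_clause_def by (metis compl_lit.simps(1))
  qed
  ultimately show "unsat_hitting F"
    by (auto simp: F_def unsat_hitting_def)
  have vars: "vars F = {v}"
    by (auto simp: F_def vars_def vars_clause_def)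
  then show "deficiency F = 1"
    by (simp add: deficiency_def F_def)
  have "full_clauses F = F"
    unfolding full_clauses_def vars by (auto simp: F_def vars_clause_def)
  then show "fc F = 2"
    by (simp add: fc_def F_def)
qed


section \<open>The number of full clauses is bounded in terms of the deficiency\<close>

lemma flipped_literal_clause:
  assumes hit: "unsat_hitting F" and D: "D \<in> full_clauses F" and l: "l \<in> D"
  shows "\<exists>G\<in>F. compl_lit l \<in> G \<and> G \<subseteq> insert (compl_lit l) (D - {l})"
proof -
  have "D \<in> F" and varsD: "vars_clause D = vars F"
    using D unfolding full_clauses_def by auto
  then have clD: "finite D" "\<And>x. x \<in> D \<Longrightarrow> compl_lit x \<notin> D"
    using hit unfolding unsat_hitting_def is_clause_set_def is_clause_def by blast+
  \<comment> \<open>Among the literals of \<open>D\<close>, \<open>E\<close> makes only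
    \<open>l\<close> true. As \<open>D\<close> is full, a clause missed by \<open>E\<close> consists
    of complements of literals of \<open>E\<close>.\<close>
  define E where "E = insert l (compl_lit ` (D - {l}))"
  have "is_clause E"
    using clD l unfolding is_clause_def E_def by auto
  then obtain G where G: "G \<in> F" "E \<inter> G = {}"
    using hit unfolding unsat_hitting_def satisfiable_def by blast
  have sub: "G \<subseteq> insert (compl_lit l) (D - {l})"
  proof
    fix m assume m: "m \<in> G"
    then have "var_of m \<in> var_of ` D"
      using varsD vars_clause_subset[OF G(1)] unfolding vars_clause_def by blast
    then obtain d where "d \<in> D" "m = d \<or> m = compl_lit d"
      by (auto simp: var_of_eq_iff)
    then show "m \<in> insert (compl_lit l) (D - {l})"
      using G(2) m unfolding E_def by blast
  qed
  \<comment> \<open>Otherwise \<open>G\<close> lies properly inside \<open>D\<close>, and its clash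
    with \<open>D\<close> gives a complementary pair in \<open>D\<close>.\<close>
  moreover have "compl_lit l \<in> G"
  proof (rule ccontr)
    assume "compl_lit l \<notin> G"
    then have GD: "G \<subseteq> D - {l}"
      using sub by (simp add: subset_insert)
    then have "G \<noteq> D"
      using l by blast
    then obtain x where "x \<in> G" "compl_lit x \<in> D"
      using hit G(1) \<open>D \<in> F\<close> unfolding unsat_hitting_def by blast
    then show False
      using clD(2) GD by blast
  qed
  ultimately show ?thesis
    using G(1) by blast
qed

lemma literal_degree_le_deficiency:
  assumes hit: "unsat_hitting F" and D: "D \<in> full_clauses F" and x: "x \<in> D"
  shows "int (card {C \<in> F. compl_lit x \<in> C}) \<le> deficiency F"
proof -
  have "D \<in> F" and varsD: "vars_clause D = vars F"
    using D unfolding full_clauses_def by auto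
  then have clD: "finite D" "\<And>y. y \<in> D \<Longrightarrow> compl_lit y \<notin> D" and finF: "finite F"
    using hit unfolding unsat_hitting_def is_clause_set_def is_clause_def by blast+
  have "inj_on var_of D"
    using clD(2) by (auto simp: inj_on_def var_of_eq_iff)
  then have card_vars: "card (vars F) = card D"
    unfolding varsD[symmetric] vars_clause_def by (rule card_image)
  have "\<exists>G. \<forall>l\<in>D. G l \<in> F \<and> compl_lit l \<in> G l \<and> G l \<subseteq> insert (compl_lit l) (D - {l})"
    using flipped_literal_clause[OF hit D] by (intro bchoice) blast
  then obtain G where G: "\<And>l. l \<in> D \<Longrightarrow> G l \<in> F" "\<And>l. l \<in> D \<Longrightarrow> compl_lit l \<in> G l"
    "\<And>l. l \<in> D \<Longrightarrow> G l \<subseteq> insert (compl_lit l) (D - {l})"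
    by blast
  \<comment> \<open>These are \<open>card D = card (vars F)\<close> clauses avoiding the complement
    of \<open>x\<close>: the only literal of \<open>G l\<close> outside \<open>D\<close> is the
    complement of \<open>l\<close>.\<close>
  define B where "B = insert D (G ` (D - {x}))"
  have "inj_on G (D - {x})"
  proof (rule inj_onI)
    fix l m assume lm: "l \<in> D - {x}" "m \<in> D - {x}" "G l = G m"
    then have "compl_lit l \<in> insert (compl_lit m) (D - {m})"
      using G(2)[of l] G(3)[of m] by auto
    then show "l = m"
      using clD(2) lm(1) by auto
  qed
  moreover have "D \<notin> G ` (D - {x})"
    using G(2) clD(2) by blast
  ultimately have cardB: "card B = card D"
    unfolding B_def using clD(1) x
    by (metis (no_types, lifting) card.remove card_image card_insert_disjoint finite_Diff
        finite_imageI)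
  have "compl_lit x \<notin> G l" if "l \<in> D - {x}" for l
    using that G(3)[of l] clD(2)[OF x] by auto
  then have "B \<subseteq> F - {C \<in> F. compl_lit x \<in> C}"
    using G(1) \<open>D \<in> F\<close> clD(2)[OF x] unfolding B_def by auto
  then have "card B \<le> card F - card {C \<in> F. compl_lit x \<in> C}"
    using finF by (metis (no_types, lifting) card_Diff_subset card_mono finite_Diff finite_subset
        mem_Collect_eq subsetI)
  moreover have "card {C \<in> F. compl_lit x \<in> C} \<le> card F"
    using finF by (intro card_mono) auto
  ultimately show ?thesis
    unfolding deficiency_def card_vars cardB by linarith
qed

lemma fc_le_double_deficiency:
  assumes hit: "unsat_hitting F" and "1 \<le> deficiency F"
  shows "int (fc F) \<le> 2 * deficiency F"
proof (cases "fc F \<le> 1")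
  case False
  then obtain C D where CD: "C \<in> full_clauses F" "D \<in> full_clauses F" "C \<noteq> D"
    unfolding fc_def by (metis card_le_Suc0_iff_eq One_nat_def card.infinite le0)
  then obtain x where x: "x \<in> C" "compl_lit x \<in> D"
    using hit unfolding unsat_hitting_def full_clauses_def by blast
  have finF: "finite F"
    using hit unfolding unsat_hitting_def is_clause_set_def by blast
  have "full_clauses F \<subseteq> {E \<in> F. compl_lit x \<in> E} \<union> {E \<in> F. x \<in> E}"
  proof
    fix E assume E: "E \<in> full_clauses F"
    then have "vars_clause E = vars_clause C"
      using CD(1) unfolding full_clauses_def by simp
    then have "var_of x \<in> var_of ` E"
      using x(1) unfolding vars_clause_def by auto
    then show "E \<in> {E \<in> F. compl_lit x \<in> E} \<union> {E \<in> F. x \<in> E}"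
      using E by (auto simp: var_of_eq_iff full_clauses_def)
  qed
  then have "fc F \<le> card ({E \<in> F. compl_lit x \<in> E} \<union> {E \<in> F. x \<in> E})"
    unfolding fc_def using finF by (intro card_mono) auto
  also have "\<dots> \<le> card {E \<in> F. compl_lit x \<in> E} + card {E \<in> F. x \<in> E}"
    by (rule card_Un_le)
  finally show ?thesis
    using literal_degree_le_deficiency[OF hit CD(1) x(1)]
      literal_degree_le_deficiency[OF hit CD(2) x(2)] by simp
qed (use assms(2) in linarith)

text \<open>\<open>Max\<close> bounds the elements only of a finite set; the bound
  \<open>2 * k\<close> provides finiteness.\<close>

lemma fc_le_FCH:
  fixes F :: "'v lit set set"
  assumes "unsat_hitting F" "deficiency F = int k" "1 \<le> k"
  shows "fc F \<le> FCH TYPE('v) k"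
proof -
  have "{fc F | F :: 'v lit set set. unsat_hitting F \<and> deficiency F = int k} \<subseteq> {..2 * k}"
    using fc_le_double_deficiency assms(3) by force
  then have "finite {fc F | F :: 'v lit set set. unsat_hitting F \<and> deficiency F = int k}"
    by (rule finite_subset) simp
  then show ?thesis
    unfolding FCH_def using assms by (intro Max_ge) auto
qed


section \<open>The recursive construction\<close>

text \<open>Stated for initial segments, so that it applies while a run is still being
  built.\<close>

lemma construction_properties:
  assumes "construction \<nu> {1..<n} F" "k \<in> {1..<n}"
  shows "unsat_hitting (F k) \<and> deficiency (F k) = int k \<and> fc (F k) = S2 k"
  using assms(2)
proof (induction k rule: less_induct)
  case (less k)
  show ?case
  proof (cases "k = 1")
    case True
    then have "F k = {{Pos (\<nu> 1)}, {Neg (\<nu> 1)}}"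
      using assms(1) less.prems unfolding construction_def by auto
    then show ?thesis
      using True unsat_hitting_unit_pair[of "\<nu> 1"] by (simp add: S2_eq_a2)
  next
    case False
    then have k: "2 \<le> k"
      using less.prems by simp
    then have exp: "full_expansion (a2 k) (F (i_S k)) (F k)"
      using assms(1) less.prems unfolding construction_def by auto
    have IH: "unsat_hitting (F (i_S k))" "deficiency (F (i_S k)) = int (i_S k)"
      using less.IH[of "i_S k"] i_S_bounds[OF k] less.prems by auto
    show ?thesis
      \<comment> \<open>The new deficiency is \<open>i_S k + a2 k - 1 = k\<close>.\<close>
      using full_expansion_properties[OF exp IH(1)] IH(2) a2_bounds[OF k]
      by (auto simp: S2_eq_a2 i_S_eq)
  qed
qed

lemma construction_step:
  assumes "construction \<nu> {1..<k} F" "2 \<le> k"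
  shows "is_clause_set (F (i_S k))" "a2 k \<le> fc (F (i_S k))"
  using construction_properties[OF assms(1), of "i_S k"] i_S_bounds[OF assms(2)]
    a2_le_S2_i_S[OF assms(2)] by (auto simp: unsat_hitting_def)

lemma construction_exists:
  fixes \<nu> :: "nat \<Rightarrow> 'v"
  assumes "infinite (UNIV :: 'v set)"
  shows "\<exists>F. construction \<nu> {1..} F"
proof -
  \<comment> \<open>\<open>P F k r\<close> says that \<open>r\<close> is admissible as stage
    \<open>k\<close> after \<open>F\<close>. Index 0 lies outside the recursion and is left
    free.\<close>
  define P where "P = (\<lambda>(F :: nat \<Rightarrow> 'v lit set set) k r.
    if k = 0 then True else if k = 1 then r = {{Pos (\<nu> 1)}, {Neg (\<nu> 1)}}
    else full_expansion (a2 k) (F (i_S k)) r)"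
  have "\<exists>F. \<forall>k. P F k (F k)"
  proof (rule dependent_wf_choice[of less_than])
    \<comment> \<open>For \<open>k \<ge> 2\<close>, \<open>P\<close> reads the sequence only at
      \<open>i_S k < k\<close>.\<close>
    show "P f k r = P g k r" if "\<And>j. (j, k) \<in> less_than \<Longrightarrow> f j = g j" for f g k r
      using that i_S_bounds[of k] unfolding P_def by auto
    show "\<exists>r. P F k r" if *: "\<And>j. (j, k) \<in> less_than \<Longrightarrow> P F j (F j)" for k F
    proof (cases "2 \<le> k")
      case True
      \<comment> \<open>The stages below \<open>k\<close> form a run, whose full clause count
        permits the next expansion.\<close>
      have "construction \<nu> {1..<k} F"
        unfolding construction_def
      proof
        fix j assume "j \<in> {1..<k}"
        then show "if j = 1 then F j = {{Pos (\<nu> 1)}, {Neg (\<nu> 1)}}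
            else full_expansion (a2 j) (F (i_S j)) (F j)"
          using *[of j] unfolding P_def by (auto split: if_splits)
      qed
      then show ?thesis
        using full_expansion_exists[OF assms] construction_step[of \<nu> k F] True
        unfolding P_def by auto
    qed (auto simp: P_def)
  qed simp
  then obtain F where F: "\<And>k. P F k (F k)"
    by blast
  have "construction \<nu> {1..} F"
    unfolding construction_def
  proof
    fix k :: nat assume "k \<in> {1..}"
    then show "if k = 1 then F k = {{Pos (\<nu> 1)}, {Neg (\<nu> 1)}}
        else full_expansion (a2 k) (F (i_S k)) (F k)"
      using F[of k] unfolding P_def by (auto split: if_splits)
  qed
  then show ?thesis
    by blast
qed

theorem theorem5p5:
  fixes \<nu> :: "nat \<Rightarrow> 'v"
  assumes "inj_on \<nu> {1..}"
  shows
    "(\<forall>k\<ge>2. i_S k \<in> {1..<k} \<and>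
        (\<forall>F. construction \<nu> {1..<k} F \<longrightarrow>
           is_clause_set (F (i_S k)) \<and> 1 \<le> a2 k \<and> a2 k \<le> fc (F (i_S k)) \<and>
           (\<exists>G. full_expansion (a2 k) (F (i_S k)) G)))
   \<and> (\<exists>F. construction \<nu> {1..} F)
   \<and> (\<forall>F. construction \<nu> {1..} F \<longrightarrow>
        (\<forall>k\<ge>1. unsat_hitting (F k) \<and> deficiency (F k) = int k \<and> fc (F k) = S2 k))
   \<and> (\<forall>k\<ge>1. S2 k \<le> FCH TYPE('v) k)"
proof -
  \<comment> \<open>The embedding makes the universe of variables infinite, so fresh variables never
    run out.\<close>
  have "infinite (\<nu> ` {1..})"
    using assms infinite_Ici finite_image_iff by blast
  then have inf: "infinite (UNIV :: 'v set)"
    by (rule infinite_super[OF subset_UNIV])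
  have step: "i_S k \<in> {1..<k} \<and>
        (\<forall>F. construction \<nu> {1..<k} F \<longrightarrow>
           is_clause_set (F (i_S k)) \<and> 1 \<le> a2 k \<and> a2 k \<le> fc (F (i_S k)) \<and>
           (\<exists>G. full_expansion (a2 k) (F (i_S k)) G))" if "k \<ge> 2" for k
    using i_S_bounds[OF that] a2_bounds[OF that] construction_step[of \<nu> k]
      full_expansion_exists[OF inf] that by auto
  have run: "unsat_hitting (F k) \<and> deficiency (F k) = int k \<and> fc (F k) = S2 k"
    if "construction \<nu> {1..} F" "k \<ge> 1" for F k
  proof (rule construction_properties)
    show "construction \<nu> {1..<Suc k} F"
      using that(1) unfolding construction_def by auto
  qed (use that(2) in auto)
  obtain F where F: "construction \<nu> {1..} F"
    using construction_exists[OF inf] by blast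
  have "S2 k \<le> FCH TYPE('v) k" if "k \<ge> 1" for k
    using run[OF F that] fc_le_FCH[of "F k" k] that by auto
  then show ?thesis
    using step run F by blast
qed

end
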